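(* Let $\mathcal{E}$ be a locally finite topos. For any object $A \in \mathcal{E}$: (1) There is an essential extension $e: A \rightarrow E$ with $E$ injective. (2) Let $e: A \rightarrow E$ be an essential extension with $E$ injective. For any other essential extension $f: A \rightarrow F$ with $F$ injective, there is an isomorphism $h: E \cong F$ with $f = he$.
   Context: "Topos" means elementary topos. A category is locally finite if for any two objects $A, B$ there are only finitely many arrows $A \rightarrow B$; a locally finite topos is a topos that is locally finite as a category. Composition is written so that $he$ means first $e$, then $h$. A monic $e: A \rightarrow B$ in $\mathcal{E}$ is essential (or an essential extension of $A$) if for every object $C \in \mathcal{E}$ and every arrow $g: B \rightarrow C$, if $ge$ is monic then $g$ is monic. An object $I$ is injective if for every monic $m: X \rightarrow Y$ and every arrow $u: X \rightarrow I$ there is an arrow $v: Y \rightarrow I$ with $vm = u$. *)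

theory Defs
  imports Main
begin

record ('o, 'a) cat =
  Ob :: "'o set"
  Ar :: "'a set"
  Dom :: "'a \<Rightarrow> 'o"
  Cod :: "'a \<Rightarrow> 'o"
  Ident :: "'o \<Rightarrow> 'a"
  Comp :: "'a \<Rightarrow> 'a \<Rightarrow> 'a"  (infixl "\<cdot>\<index>" 70)

text \<open>Composition is in applicative order: \<open>g \<cdot> f\<close> is first \<open>f\<close>, then \<open>g\<close>. Its values on
  non-composable pairs, and the values of all operations outside \<open>Ob\<close> and \<open>Ar\<close>, are irrelevant.\<close>

definition hom :: "('o, 'a, 'm) cat_scheme \<Rightarrow> 'o \<Rightarrow> 'o \<Rightarrow> 'a set"
  where "hom C A B = {f \<in> Ar C. Dom C f = A \<and> Cod C f = B}"

locale category =
  fixes C :: "('o, 'a, 'm) cat_scheme" (structure)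
  assumes Dom_closed: "f \<in> Ar C \<Longrightarrow> Dom C f \<in> Ob C"
    and Cod_closed: "f \<in> Ar C \<Longrightarrow> Cod C f \<in> Ob C"
    and Ident_hom: "A \<in> Ob C \<Longrightarrow> Ident C A \<in> hom C A A"
    and Comp_hom: "\<lbrakk>f \<in> hom C X Y; g \<in> hom C Y Z\<rbrakk> \<Longrightarrow> g \<cdot> f \<in> hom C X Z"
    and Comp_Ident: "f \<in> hom C X Y \<Longrightarrow> f \<cdot> Ident C X = f"
    and Ident_Comp: "f \<in> hom C X Y \<Longrightarrow> Ident C Y \<cdot> f = f"
    and Comp_assoc: "\<lbrakk>f \<in> hom C W X; g \<in> hom C X Y; h \<in> hom C Y Z\<rbrakk>
      \<Longrightarrow> (h \<cdot> g) \<cdot> f = h \<cdot> (g \<cdot> f)"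

definition monic :: "('o, 'a, 'm) cat_scheme \<Rightarrow> 'a \<Rightarrow> bool"
  where "monic C m \<longleftrightarrow> m \<in> Ar C \<and>
    (\<forall>X \<in> Ob C. \<forall>f \<in> hom C X (Dom C m). \<forall>g \<in> hom C X (Dom C m).
      m \<cdot>\<^bsub>C\<^esub> f = m \<cdot>\<^bsub>C\<^esub> g \<longrightarrow> f = g)"

definition iso_between :: "('o, 'a, 'm) cat_scheme \<Rightarrow> 'a \<Rightarrow> 'o \<Rightarrow> 'o \<Rightarrow> bool"
  where "iso_between C h A B \<longleftrightarrow> h \<in> hom C A B \<and>
    (\<exists>k \<in> hom C B A. k \<cdot>\<^bsub>C\<^esub> h = Ident C A \<and> h \<cdot>\<^bsub>C\<^esub> k = Ident C B)"

subsection \<open>Finite limits\<close>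

text \<open>A finite diagram is indexed by a finite directed graph with vertices \<open>V\<close>, edges \<open>E\<close>, source
  \<open>s\<close> and target \<open>t\<close>; \<open>D\<close> and \<open>d\<close> label the vertices with objects and the edges with arrows.
  Every finite graph has an isomorphic copy inside \<open>nat\<close>, so indexing by \<open>nat\<close> is no
  restriction.\<close>

definition finite_diagram ::
  "('o, 'a, 'm) cat_scheme \<Rightarrow> nat set \<Rightarrow> nat set \<Rightarrow> (nat \<Rightarrow> nat) \<Rightarrow> (nat \<Rightarrow> nat)
    \<Rightarrow> (nat \<Rightarrow> 'o) \<Rightarrow> (nat \<Rightarrow> 'a) \<Rightarrow> bool"
  where "finite_diagram C V E s t D d \<longleftrightarrow>
    finite V \<and> finite E \<and> (\<forall>v \<in> V. D v \<in> Ob C) \<and>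
    (\<forall>e \<in> E. s e \<in> V \<and> t e \<in> V \<and> d e \<in> hom C (D (s e)) (D (t e)))"

definition is_cone ::
  "('o, 'a, 'm) cat_scheme \<Rightarrow> nat set \<Rightarrow> nat set \<Rightarrow> (nat \<Rightarrow> nat) \<Rightarrow> (nat \<Rightarrow> nat)
    \<Rightarrow> (nat \<Rightarrow> 'o) \<Rightarrow> (nat \<Rightarrow> 'a) \<Rightarrow> 'o \<Rightarrow> (nat \<Rightarrow> 'a) \<Rightarrow> bool"
  where "is_cone C V E s t D d L p \<longleftrightarrow>
    L \<in> Ob C \<and> (\<forall>v \<in> V. p v \<in> hom C L (D v)) \<and>
    (\<forall>e \<in> E. d e \<cdot>\<^bsub>C\<^esub> p (s e) = p (t e))"

definition is_limit ::
  "('o, 'a, 'm) cat_scheme \<Rightarrow> nat set \<Rightarrow> nat set \<Rightarrow> (nat \<Rightarrow> nat) \<Rightarrow> (nat \<Rightarrow> nat)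
    \<Rightarrow> (nat \<Rightarrow> 'o) \<Rightarrow> (nat \<Rightarrow> 'a) \<Rightarrow> 'o \<Rightarrow> (nat \<Rightarrow> 'a) \<Rightarrow> bool"
  where "is_limit C V E s t D d L p \<longleftrightarrow> is_cone C V E s t D d L p \<and>
    (\<forall>X q. is_cone C V E s t D d X q \<longrightarrow>
      (\<exists>!u. u \<in> hom C X L \<and> (\<forall>v \<in> V. p v \<cdot>\<^bsub>C\<^esub> u = q v)))"

definition has_finite_limits :: "('o, 'a, 'm) cat_scheme \<Rightarrow> bool"
  where "has_finite_limits C \<longleftrightarrow>
    (\<forall>V E s t D d. finite_diagram C V E s t D d \<longrightarrow> (\<exists>L p. is_limit C V E s t D d L p))"

definition is_terminal :: "('o, 'a, 'm) cat_scheme \<Rightarrow> 'o \<Rightarrow> bool"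
  where "is_terminal C T \<longleftrightarrow> T \<in> Ob C \<and> (\<forall>X \<in> Ob C. \<exists>!t. t \<in> hom C X T)"

definition is_product ::
  "('o, 'a, 'm) cat_scheme \<Rightarrow> 'o \<Rightarrow> 'o \<Rightarrow> 'o \<Rightarrow> 'a \<Rightarrow> 'a \<Rightarrow> bool"
  where "is_product C A B P p q \<longleftrightarrow> p \<in> hom C P A \<and> q \<in> hom C P B \<and>
    (\<forall>X. \<forall>f \<in> hom C X A. \<forall>g \<in> hom C X B.
      \<exists>!u. u \<in> hom C X P \<and> p \<cdot>\<^bsub>C\<^esub> u = f \<and> q \<cdot>\<^bsub>C\<^esub> u = g)"

text \<open>\<open>is_pullback C f g p q\<close>: the square \<open>f \<cdot> p = g \<cdot> q\<close> is a pullback of \<open>f\<close> and \<open>g\<close>.\<close>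

definition is_pullback ::
  "('o, 'a, 'm) cat_scheme \<Rightarrow> 'a \<Rightarrow> 'a \<Rightarrow> 'a \<Rightarrow> 'a \<Rightarrow> bool"
  where "is_pullback C f g p q \<longleftrightarrow>
    f \<in> Ar C \<and> g \<in> Ar C \<and> Cod C f = Cod C g \<and>
    p \<in> hom C (Dom C p) (Dom C f) \<and> q \<in> hom C (Dom C p) (Dom C g) \<and>
    f \<cdot>\<^bsub>C\<^esub> p = g \<cdot>\<^bsub>C\<^esub> q \<and>
    (\<forall>X. \<forall>x \<in> hom C X (Dom C f). \<forall>y \<in> hom C X (Dom C g).
      f \<cdot>\<^bsub>C\<^esub> x = g \<cdot>\<^bsub>C\<^esub> y \<longrightarrow>
      (\<exists>!u. u \<in> hom C X (Dom C p) \<and> p \<cdot>\<^bsub>C\<^esub> u = x \<and> q \<cdot>\<^bsub>C\<^esub> u = y))"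

subsection \<open>Toposes\<close>

text \<open>\<open>W\<close> is an exponential of \<open>B\<close> by \<open>A\<close>, with evaluation \<open>ev\<close> defined on a product \<open>P\<close> of \<open>W\<close>
  and \<open>A\<close>. For a product \<open>Q\<close> of \<open>X\<close> and \<open>A\<close>, the arrow \<open>h : Q \<rightarrow> P\<close> below is \<open>g \<times> A\<close>.\<close>

definition is_exponential ::
  "('o, 'a, 'm) cat_scheme \<Rightarrow> 'o \<Rightarrow> 'o \<Rightarrow> 'o \<Rightarrow> 'o \<Rightarrow> 'a \<Rightarrow> 'a \<Rightarrow> 'a \<Rightarrow> bool"
  where "is_exponential C A B W P p q ev \<longleftrightarrow>
    is_product C W A P p q \<and> ev \<in> hom C P B \<and>
    (\<forall>X Q r s f. is_product C X A Q r s \<and> f \<in> hom C Q B \<longrightarrow>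
      (\<exists>!g. g \<in> hom C X W \<and>
        (\<exists>h \<in> hom C Q P. p \<cdot>\<^bsub>C\<^esub> h = g \<cdot>\<^bsub>C\<^esub> r \<and> q \<cdot>\<^bsub>C\<^esub> h = s \<and> ev \<cdot>\<^bsub>C\<^esub> h = f)))"

definition has_exponentials :: "('o, 'a, 'm) cat_scheme \<Rightarrow> bool"
  where "has_exponentials C \<longleftrightarrow>
    (\<forall>A \<in> Ob C. \<forall>B \<in> Ob C. \<exists>W P p q ev. is_exponential C A B W P p q ev)"

definition is_subobject_classifier ::
  "('o, 'a, 'm) cat_scheme \<Rightarrow> 'o \<Rightarrow> 'o \<Rightarrow> 'a \<Rightarrow> bool"
  where "is_subobject_classifier C T \<Omega> tr \<longleftrightarrow>
    is_terminal C T \<and> tr \<in> hom C T \<Omega> \<and>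
    (\<forall>S X m. m \<in> hom C S X \<and> monic C m \<longrightarrow>
      (\<exists>!\<chi>. \<chi> \<in> hom C X \<Omega> \<and> (\<exists>t \<in> hom C S T. is_pullback C \<chi> tr m t)))"

locale elementary_topos = category +
  assumes finite_limits: "has_finite_limits C"
    and exponentials: "has_exponentials C"
    and subobject_classifier: "\<exists>T \<Omega> tr. is_subobject_classifier C T \<Omega> tr"

locale locally_finite_topos = elementary_topos +
  assumes locally_finite: "\<lbrakk>A \<in> Ob C; B \<in> Ob C\<rbrakk> \<Longrightarrow> finite (hom C A B)"

subsection \<open>Essential extensions and injective objects\<close>

definition essential_extension :: "('o, 'a, 'm) cat_scheme \<Rightarrow> 'o \<Rightarrow> 'a \<Rightarrow> 'o \<Rightarrow> bool"
  where "essential_extension C A e B \<longleftrightarrow> e \<in> hom C A B \<and> monic C e \<and>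
    (\<forall>Z \<in> Ob C. \<forall>g \<in> hom C B Z. monic C (g \<cdot>\<^bsub>C\<^esub> e) \<longrightarrow> monic C g)"

definition injective_object :: "('o, 'a, 'm) cat_scheme \<Rightarrow> 'o \<Rightarrow> bool"
  where "injective_object C I \<longleftrightarrow> I \<in> Ob C \<and>
    (\<forall>X Y. \<forall>m \<in> hom C X Y. \<forall>u \<in> hom C X I.
      monic C m \<longrightarrow> (\<exists>v \<in> hom C Y I. v \<cdot>\<^bsub>C\<^esub> m = u))"

end

theory Submission
  imports Defs
begin

text \<open>The power object \<open>\<Omega>\<^sup>A\<close> is injective and receives the singleton monic from \<open>A\<close>. Among all
  monics \<open>e : A \<rightarrow> E\<close> with \<open>E\<close> injective, choose one whose finite monoid \<open>hom E E\<close> has least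
  cardinality. Splitting an idempotent \<open>t\<close> with \<open>t \<cdot> e = e\<close> yields another such monic, with a
  strictly smaller monoid unless \<open>t\<close> is an identity; so \<open>t\<close> is an identity. If \<open>u : E \<rightarrow> E\<close>
  satisfies \<open>u \<cdot> e = e\<close>, then the finite semigroup of all \<open>y \<cdot> u\<close> fixing \<open>e\<close> contains an
  idempotent, hence the identity, and \<open>u\<close> is split monic. By injectivity of \<open>E\<close> this suffices for
  \<open>e\<close> to be essential. Uniqueness holds because monic endomorphisms in a locally finite category
  are invertible.\<close>

text \<open>For x in \<open>S\<close>, the right ideal xS is nonempty and closed. If xS = S, then
  the set of all y with xy = x is nonempty and closed too. Either one of the two is a proper subset,
  to which induction applies, or both equal \<open>S\<close> and then xx = x. The laws are assumed
  on \<open>S\<close> only, since composition obeys them only on composable arrows.\<close>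

lemma finite_semigroup_idempotent:
  fixes mult :: "'b \<Rightarrow> 'b \<Rightarrow> 'b"
  assumes "finite S" "S \<noteq> {}"
    and closed: "\<And>x y. x \<in> S \<Longrightarrow> y \<in> S \<Longrightarrow> mult x y \<in> S"
    and assoc: "\<And>x y z. x \<in> S \<Longrightarrow> y \<in> S \<Longrightarrow> z \<in> S
      \<Longrightarrow> mult (mult x y) z = mult x (mult y z)"
  shows "\<exists>x \<in> S. mult x x = x"
  using assms
proof (induction S rule: finite_psubset_induct)
  case (psubset S)
  have shrink: ?case if K: "K \<subset> S" "K \<noteq> {}" "\<And>y z. y \<in> K \<Longrightarrow> z \<in> K \<Longrightarrow> mult y z \<in> K" for K
  proof -
    have "\<exists>x \<in> K. mult x x = x"
    proof (rule psubset.IH[OF K])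
      fix x y z assume "x \<in> K" "y \<in> K" "z \<in> K"
      then show "mult (mult x y) z = mult x (mult y z)"
        using K(1) psubset.prems(3) by blast
    qed
    then show ?thesis
      using K(1) by blast
  qed
  obtain x where x: "x \<in> S"
    using psubset.prems(1) by blast
  have sub: "mult x ` S \<subseteq> S"
    using x psubset.prems(2) by blast
  show ?case
  proof (cases "mult x ` S = S")
    case False
    show ?thesis
    proof (rule shrink)
      show "mult x ` S \<subset> S"
        using sub False by blast
      show "mult x ` S \<noteq> {}"
        using x by blast
      fix y z assume "y \<in> mult x ` S" "z \<in> mult x ` S"
      then obtain b where "b \<in> S" "y = mult x b" "z \<in> S"
        using sub by blast
      then show "mult y z \<in> mult x ` S"
        using x psubset.prems(2,3) by auto
    qed
  next
    case True
    let ?K = "{y \<in> S. mult x y = x}"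
    show ?thesis
    proof (cases "?K = S")
      case True
      then show ?thesis
        using x by blast
    next
      case False
      show ?thesis
      proof (rule shrink)
        show "?K \<subset> S"
          using False by blast
        show "?K \<noteq> {}"
        proof -
          have "x \<in> mult x ` S"
            using x \<open>mult x ` S = S\<close> by simp
          then show ?thesis
            by auto
        qed
        fix y z assume "y \<in> ?K" "z \<in> ?K"
        then show "mult y z \<in> ?K"
          using x psubset.prems(2) psubset.prems(3)[of x y z] by simp
      qed
    qed
  qed
qed

section \<open>Monics, retracts of injectives and uniqueness of injective hulls\<close>

context category
begin

lemma homD:
  assumes "f \<in> hom C X Y"
  shows "f \<in> Ar C" "Dom C f = X" "Cod C f = Y" "X \<in> Ob C" "Y \<in> Ob C"
  using assms Dom_closed Cod_closed by (auto simp: hom_def)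

lemma monicI:
  assumes "m \<in> hom C X Y"
    and "\<And>Z f g. f \<in> hom C Z X \<Longrightarrow> g \<in> hom C Z X \<Longrightarrow> m \<cdot> f = m \<cdot> g \<Longrightarrow> f = g"
  shows "monic C m"
  using assms unfolding monic_def by (auto dest: homD)

lemma monicD:
  assumes "monic C m" "m \<in> hom C X Y" "f \<in> hom C Z X" "g \<in> hom C Z X" "m \<cdot> f = m \<cdot> g"
  shows "f = g"
  using assms homD(2)[OF assms(2)] homD(4)[OF assms(3)] unfolding monic_def by auto

lemma monic_Comp:
  assumes "monic C m" "monic C n" and m: "m \<in> hom C X Y" and n: "n \<in> hom C Y Z"
  shows "monic C (n \<cdot> m)"
proof (rule monicI[OF Comp_hom[OF m n]])
  fix W f g assume f: "f \<in> hom C W X" and g: "g \<in> hom C W X" and "(n \<cdot> m) \<cdot> f = (n \<cdot> m) \<cdot> g"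
  then have "n \<cdot> (m \<cdot> f) = n \<cdot> (m \<cdot> g)"
    using Comp_assoc m n by metis
  then have "m \<cdot> f = m \<cdot> g"
    using monicD[OF assms(2) n] Comp_hom f g m by blast
  then show "f = g"
    using monicD[OF assms(1) m] f g by blast
qed

lemma monic_of_monic_Comp:
  assumes "monic C (n \<cdot> m)" and m: "m \<in> hom C X Y" and n: "n \<in> hom C Y Z"
  shows "monic C m"
proof (rule monicI[OF m])
  fix W f g assume f: "f \<in> hom C W X" and g: "g \<in> hom C W X" and "m \<cdot> f = m \<cdot> g"
  then have "(n \<cdot> m) \<cdot> f = (n \<cdot> m) \<cdot> g"
    using Comp_assoc m n by metis
  then show "f = g"
    using monicD[OF assms(1) Comp_hom[OF m n]] f g by blast
qed

lemma monic_Ident: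
  assumes "X \<in> Ob C"
  shows "monic C (Ident C X)"
  using monicI[OF Ident_hom[OF assms]] Ident_Comp by metis

lemma product_ext:
  assumes P: "is_product C A B P p q" and x: "x \<in> hom C X P" and y: "y \<in> hom C X P"
    and "p \<cdot> x = p \<cdot> y" "q \<cdot> x = q \<cdot> y"
  shows "x = y"
proof -
  have "p \<cdot> x \<in> hom C X A" "q \<cdot> x \<in> hom C X B"
    using P x Comp_hom unfolding is_product_def by blast+
  then have "\<exists>!u. u \<in> hom C X P \<and> p \<cdot> u = p \<cdot> x \<and> q \<cdot> u = q \<cdot> x"
    using P unfolding is_product_def by blast
  then show ?thesis
    using assms by metis
qed

lemma product_pairing:
  assumes "is_product C A B P p q" "f \<in> hom C X A" "g \<in> hom C X B"
  obtains u where "u \<in> hom C X P" "p \<cdot> u = f" "q \<cdot> u = g"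
  using assms unfolding is_product_def by blast

lemma injective_extend:
  assumes "injective_object C I" "monic C m" "m \<in> hom C X Y" "u \<in> hom C X I"
  obtains v where "v \<in> hom C Y I" "v \<cdot> m = u"
  using assms unfolding injective_object_def by blast

text \<open>Extend \<open>s \<cdot> u\<close> along \<open>m\<close> into \<open>I\<close>, then
  return to \<open>J\<close> along \<open>r\<close>.\<close>

lemma injective_retract:
  assumes I: "injective_object C I" and s: "s \<in> hom C J I" and r: "r \<in> hom C I J"
    and rs: "r \<cdot> s = Ident C J"
  shows "injective_object C J"
  unfolding injective_object_def
proof (intro conjI allI ballI impI)
  show "J \<in> Ob C"
    using s homD by blast
  fix X Y m u assume m: "m \<in> hom C X Y" and u: "u \<in> hom C X J" and "monic C m"
  then obtain v where v: "v \<in> hom C Y I" "v \<cdot> m = s \<cdot> u"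
    using injective_extend[OF I] Comp_hom[OF u s] by blast
  have "(r \<cdot> v) \<cdot> m = r \<cdot> (s \<cdot> u)"
    using Comp_assoc[OF m v(1) r] v(2) by simp
  also have "\<dots> = u"
    using Comp_assoc[OF u s r] rs Ident_Comp[OF u] by simp
  finally show "\<exists>v \<in> hom C Y J. v \<cdot> m = u"
    using Comp_hom[OF v(1) r] by blast
qed

text \<open>Composition with a monic is an injective, hence surjective, self-map of the finite set
  \<open>hom C X X\<close>.\<close>

lemma monic_endo_inverse:
  assumes fin: "finite (hom C X X)" and u: "u \<in> hom C X X" and mon: "monic C u"
  obtains w where "w \<in> hom C X X" "w \<cdot> u = Ident C X" "u \<cdot> w = Ident C X"
proof -
  have X: "Ident C X \<in> hom C X X"
    using u homD Ident_hom by blast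
  have "inj_on (\<lambda>x. u \<cdot> x) (hom C X X)"
    using monicD[OF mon u] by (auto intro: inj_onI)
  moreover have "(\<lambda>x. u \<cdot> x) ` hom C X X \<subseteq> hom C X X"
    using Comp_hom u by blast
  ultimately have "(\<lambda>x. u \<cdot> x) ` hom C X X = hom C X X"
    using fin endo_inj_surj by blast
  then obtain w where w: "w \<in> hom C X X" "u \<cdot> w = Ident C X"
    using X by (metis imageE)
  have "u \<cdot> (w \<cdot> u) = (u \<cdot> w) \<cdot> u"
    using Comp_assoc[OF u w(1) u] by simp
  also have "\<dots> = u \<cdot> Ident C X"
    using w Ident_Comp[OF u] Comp_Ident[OF u] by simp
  finally have "w \<cdot> u = Ident C X"
    using monicD[OF mon u _ X] Comp_hom u w by blast
  then show thesis
    using that w by blast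
qed

text \<open>Injectivity gives comparison arrows \<open>h\<close> and \<open>k\<close> under
  \<open>A\<close> in both directions, and essentiality makes them monic. Both composites are then
  monic endomorphisms, invertible by finiteness.\<close>

lemma essential_injective_unique:
  assumes fE: "finite (hom C E E)" and fF: "finite (hom C F F)"
    and e: "essential_extension C A e E" and E: "injective_object C E"
    and f: "essential_extension C A f F" and F: "injective_object C F"
  shows "\<exists>h. iso_between C h E F \<and> f = h \<cdot> e"
proof -
  have eh: "e \<in> hom C A E" "monic C e" and fh: "f \<in> hom C A F" "monic C f"
    using e f unfolding essential_extension_def by auto
  obtain h where h: "h \<in> hom C E F" "h \<cdot> e = f"
    using injective_extend[OF F eh(2,1) fh(1)] by blast
  obtain k where k: "k \<in> hom C F E" "k \<cdot> f = e"
    using injective_extend[OF E fh(2,1) eh(1)] by blast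
  have mh: "monic C h"
    using e h fh(2) homD(5)[OF h(1)] unfolding essential_extension_def by blast
  have mk: "monic C k"
    using f k eh(2) homD(5)[OF k(1)] unfolding essential_extension_def by blast
  obtain w where w: "w \<in> hom C E E" "w \<cdot> (k \<cdot> h) = Ident C E"
    using monic_endo_inverse[OF fE Comp_hom[OF h(1) k(1)] monic_Comp[OF mh mk h(1) k(1)]] by blast
  obtain z where z: "z \<in> hom C F F" "(h \<cdot> k) \<cdot> z = Ident C F"
    using monic_endo_inverse[OF fF Comp_hom[OF k(1) h(1)] monic_Comp[OF mk mh k(1) h(1)]] by blast
  \<comment> \<open>A left and a right inverse of \<open>h\<close>, which therefore
    coincide.\<close>
  let ?l = "w \<cdot> k" and ?r = "k \<cdot> z"
  have l: "?l \<in> hom C F E" "?l \<cdot> h = Ident C E"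
    using Comp_hom[OF k(1) w(1)] Comp_assoc[OF h(1) k(1) w(1)] w(2) by auto
  have r: "?r \<in> hom C F E" "h \<cdot> ?r = Ident C F"
    using Comp_hom[OF z(1) k(1)] Comp_assoc[OF z(1) k(1) h(1)] z(2) by auto
  have "?l = ?l \<cdot> (h \<cdot> ?r)"
    using r(2) Comp_Ident[OF l(1)] by simp
  also have "\<dots> = ?r"
    using Comp_assoc[OF r(1) h(1) l(1)] l(2) Ident_Comp[OF r(1)] by simp
  finally have "iso_between C h E F"
    using h l r unfolding iso_between_def by metis
  then show ?thesis
    using h by blast
qed

end

section \<open>Finite limits, splitting of idempotents and injective power objects\<close>

context elementary_topos
begin

lemma binary_product:
  assumes "A \<in> Ob C" "B \<in> Ob C"
  obtains P p q where "is_product C A B P p q"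
proof -
  \<comment> \<open>The discrete diagram on two vertices; its edge labelling is
    \<open>undefined\<close> because there are no edges to label.\<close>
  let ?D = "\<lambda>v::nat. if v = 0 then A else B"
  have "finite_diagram C {0,1} {} id id ?D undefined"
    using assms by (simp add: finite_diagram_def)
  then obtain P p where P: "is_limit C {0,1} {} id id ?D undefined P p"
    using finite_limits unfolding has_finite_limits_def by meson
  have "\<exists>!u. u \<in> hom C X P \<and> p 0 \<cdot> u = f \<and> p 1 \<cdot> u = g"
    if "f \<in> hom C X A" "g \<in> hom C X B" for X f g
  proof -
    have "is_cone C {0,1} {} id id ?D undefined X (\<lambda>v. if v = 0 then f else g)"
      using that homD by (auto simp: is_cone_def)
    then have "\<exists>!u. u \<in> hom C X P \<and> (\<forall>v \<in> {0,1}. p v \<cdot> u = (if v = 0 then f else g))"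
      using P unfolding is_limit_def by blast
    then show ?thesis
      by simp
  qed
  moreover have "p 0 \<in> hom C P A" "p 1 \<in> hom C P B"
    using P by (auto simp: is_limit_def is_cone_def)
  ultimately have "is_product C A B P (p 0) (p 1)"
    unfolding is_product_def by blast
  then show thesis
    using that by blast
qed

lemma pullback_exists:
  assumes f: "f \<in> hom C X Z" and g: "g \<in> hom C Y Z"
  obtains P p q where "is_pullback C f g p q" "p \<in> hom C P X" "q \<in> hom C P Y"
proof -
  \<comment> \<open>The cospan with vertex 2 as common target: edge 0 is \<open>f\<close> from
    vertex 0, edge 1 is \<open>g\<close> from vertex 1.\<close>
  let ?V = "{0,1,2::nat}" and ?E = "{0,1::nat}"
  let ?D = "\<lambda>v::nat. if v = 0 then X else if v = 1 then Y else Z"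
  let ?d = "\<lambda>e::nat. if e = 0 then f else g"
  have "finite_diagram C ?V ?E id (\<lambda>_. 2) ?D ?d"
    using f g homD by (auto simp: finite_diagram_def)
  then obtain P p where P: "is_limit C ?V ?E id (\<lambda>_. 2) ?D ?d P p"
    using finite_limits unfolding has_finite_limits_def by meson
  then have p: "p 0 \<in> hom C P X" "p 1 \<in> hom C P Y" "f \<cdot> p 0 = p 2" "g \<cdot> p 1 = p 2"
    by (auto simp: is_limit_def is_cone_def)
  have "\<exists>!u. u \<in> hom C W P \<and> p 0 \<cdot> u = x \<and> p 1 \<cdot> u = y"
    if x: "x \<in> hom C W X" and y: "y \<in> hom C W Y" and eq: "f \<cdot> x = g \<cdot> y" for W x y
  proof -
    let ?q = "\<lambda>v::nat. if v = 0 then x else if v = 1 then y else f \<cdot> x"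
    have "is_cone C ?V ?E id (\<lambda>_. 2) ?D ?d W ?q"
      using x y eq homD(4)[OF x] Comp_hom[OF x f] by (auto simp: is_cone_def)
    then have "\<exists>!u. u \<in> hom C W P \<and> (\<forall>v \<in> ?V. p v \<cdot> u = ?q v)"
      using P unfolding is_limit_def by blast
    \<comment> \<open>The leg at vertex 2 is \<open>f \<cdot> p 0\<close>, so the condition there
      follows from the one at vertex 0.\<close>
    moreover have "(\<forall>v \<in> ?V. p v \<cdot> u = ?q v) \<longleftrightarrow> p 0 \<cdot> u = x \<and> p 1 \<cdot> u = y"
      if "u \<in> hom C W P" for u
      using Comp_assoc[OF that p(1) f] p(3) by auto
    ultimately show ?thesis
      by (metis (no_types, lifting))
  qed
  then have "is_pullback C f g (p 0) (p 1)"
    using p homD[OF f] homD[OF g] homD[OF p(1)] unfolding is_pullback_def by simp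
  then show thesis
    using that p by blast
qed

text \<open>The arrow \<open>s\<close> is the equalizer of \<open>t\<close> and the identity.
  Idempotence says that \<open>t\<close> itself equalizes this pair, and \<open>r\<close> is the
  resulting factorization of \<open>t\<close> through \<open>s\<close>.\<close>

lemma idempotent_splits:
  assumes t: "t \<in> hom C X X" and idem: "t \<cdot> t = t"
  obtains Y s r where "s \<in> hom C Y X" "r \<in> hom C X Y" "r \<cdot> s = Ident C Y" "s \<cdot> r = t"
proof -
  have X: "X \<in> Ob C" "Ident C X \<in> hom C X X"
    using t homD Ident_hom by blast+
  let ?d = "\<lambda>e::nat. if e = 0 then t else Ident C X"
  have "finite_diagram C {0,1} {0,1} (\<lambda>_. 0) (\<lambda>_. 1) (\<lambda>_. X) ?d"
    using t X by (auto simp: finite_diagram_def)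
  then obtain Y p where Y: "is_limit C {0,1} {0,1} (\<lambda>_. 0) (\<lambda>_. 1) (\<lambda>_. X) ?d Y p"
    using finite_limits unfolding has_finite_limits_def by meson
  let ?s = "p 0"
  have s: "?s \<in> hom C Y X" and p1: "t \<cdot> ?s = p 1" "Ident C X \<cdot> ?s = p 1"
    using Y by (auto simp: is_limit_def is_cone_def)
  then have ts: "t \<cdot> ?s = ?s" "p 1 = ?s"
    using Ident_Comp[OF s] by auto
  have univ: "\<exists>!u. u \<in> hom C W Y \<and> ?s \<cdot> u = x" if x: "x \<in> hom C W X" "t \<cdot> x = x" for W x
  proof -
    have "is_cone C {0,1} {0,1} (\<lambda>_. 0) (\<lambda>_. 1) (\<lambda>_. X) ?d W (\<lambda>_. x)"
      using x homD Ident_Comp by (auto simp: is_cone_def)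
    then have "\<exists>!u. u \<in> hom C W Y \<and> (\<forall>v \<in> {0,1}. p v \<cdot> u = x)"
      using Y unfolding is_limit_def by blast
    then show ?thesis
      using ts(2) by simp
  qed
  obtain r where r: "r \<in> hom C X Y" "?s \<cdot> r = t"
    using univ[OF t idem] by blast
  have YI: "Ident C Y \<in> hom C Y Y"
    using s homD Ident_hom by blast
  \<comment> \<open>Both \<open>r \<cdot> ?s\<close> and the identity factor \<open>?s\<close>
    through itself; uniqueness identifies them.\<close>
  have "?s \<cdot> (r \<cdot> ?s) = ?s"
    using Comp_assoc[OF s r(1) s] r(2) ts by simp
  then have "r \<cdot> ?s = Ident C Y"
    using univ[OF s ts(1)] Comp_hom[OF s r(1)] YI Comp_Ident[OF s] by blast
  then show thesis
    using that s r by blast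
qed

text \<open>The arrow \<open>u\<close> classifies a subobject \<open>p\<close> of \<open>X\<close>.
  Composed with \<open>m\<close> it becomes a subobject of \<open>Y\<close>, with characteristic
  arrow \<open>v\<close>. Restricting \<open>v\<close> along the monic \<open>m\<close> gives back
  \<open>p\<close>, so \<open>v \<cdot> m\<close> and \<open>u\<close> classify the same
  subobject.\<close>

lemma classifier_injective:
  assumes cl: "is_subobject_classifier C T \<Omega> tr"
  shows "injective_object C \<Omega>"
proof -
  have T: "is_terminal C T" and tr: "tr \<in> hom C T \<Omega>"
    using cl unfolding is_subobject_classifier_def by auto
  have Teq: "a = b" if "a \<in> hom C Z T" "b \<in> hom C Z T" for a b Z
    using T that homD(4) unfolding is_terminal_def by blast
  have "\<exists>v \<in> hom C Y \<Omega>. v \<cdot> m = u"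
    if m: "m \<in> hom C X Y" and u: "u \<in> hom C X \<Omega>" and mon: "monic C m" for X Y m u
  proof -
    obtain S p q where pb: "is_pullback C u tr p q" and p: "p \<in> hom C S X" and q: "q \<in> hom C S T"
      using pullback_exists[OF u tr] by blast
    \<comment> \<open>Arrows into the terminal object are unique, so equality after \<open>p\<close>
      already forces equality after \<open>q\<close>.\<close>
    have pmon: "monic C p"
    proof (rule monicI[OF p])
      fix Z f g assume f: "f \<in> hom C Z S" and g: "g \<in> hom C Z S" and eq: "p \<cdot> f = p \<cdot> g"
      have "u \<cdot> (p \<cdot> f) = tr \<cdot> (q \<cdot> f)"
        using pb Comp_assoc[OF f p u] Comp_assoc[OF f q tr] by (simp add: is_pullback_def)
      then have "\<exists>!w. w \<in> hom C Z S \<and> p \<cdot> w = p \<cdot> f \<and> q \<cdot> w = q \<cdot> f"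
        using pb homD[OF u] homD[OF tr] homD[OF p] Comp_hom[OF f p] Comp_hom[OF f q]
        unfolding is_pullback_def by simp
      moreover have "q \<cdot> f = q \<cdot> g"
        using Teq Comp_hom f g q by blast
      ultimately show "f = g"
        using f g eq by metis
    qed
    have mp: "m \<cdot> p \<in> hom C S Y"
      using Comp_hom p m by blast
    obtain v t where v: "v \<in> hom C Y \<Omega>" and t: "t \<in> hom C S T"
      and vpb: "is_pullback C v tr (m \<cdot> p) t"
      using cl mp monic_Comp[OF pmon mon p m] unfolding is_subobject_classifier_def by blast
    have vm: "v \<cdot> m \<in> hom C X \<Omega>"
      using Comp_hom m v by blast
    \<comment> \<open>The square for \<open>v\<close> restricts to one for
      \<open>v \<cdot> m\<close>: as \<open>m\<close> is monic, factoring \<open>m \<cdot> x\<close>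
      through \<open>m \<cdot> p\<close> is the same as factoring \<open>x\<close> through
      \<open>p\<close>.\<close>
    have "\<exists>!w. w \<in> hom C Z S \<and> p \<cdot> w = x \<and> t \<cdot> w = y"
      if x: "x \<in> hom C Z X" and y: "y \<in> hom C Z T" and eq: "(v \<cdot> m) \<cdot> x = tr \<cdot> y" for Z x y
    proof -
      have "v \<cdot> (m \<cdot> x) = tr \<cdot> y"
        using eq Comp_assoc[OF x m v] by simp
      then have "\<exists>!w. w \<in> hom C Z S \<and> (m \<cdot> p) \<cdot> w = m \<cdot> x \<and> t \<cdot> w = y"
        using vpb homD[OF v] homD[OF tr] homD[OF mp] Comp_hom[OF x m] y
        unfolding is_pullback_def by simp
      moreover have "(m \<cdot> p) \<cdot> w = m \<cdot> x \<longleftrightarrow> p \<cdot> w = x" if w: "w \<in> hom C Z S" for w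
        using Comp_assoc[OF w p m] monicD[OF mon m Comp_hom[OF w p] x] by auto
      ultimately show ?thesis
        by (metis (no_types, lifting))
    qed
    moreover have "(v \<cdot> m) \<cdot> p = tr \<cdot> t"
      using Comp_assoc[OF p m v] vpb by (simp add: is_pullback_def)
    ultimately have "is_pullback C (v \<cdot> m) tr p t"
      using homD[OF vm] homD[OF tr] homD[OF p] p t unfolding is_pullback_def by simp
    then have "v \<cdot> m = u"
      using cl p pmon vm u pb q t unfolding is_subobject_classifier_def by blast
    then show ?thesis
      using v by blast
  qed
  then show ?thesis
    using tr homD(5) unfolding injective_object_def by blast
qed

text \<open>Transposition turns an extension problem along \<open>m\<close> into \<open>W\<close>
  into one along m \<times> A into \<open>I\<close>, and m \<times> A is monic whenever
  \<open>m\<close> is.\<close>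

lemma exponential_injective:
  assumes ex: "is_exponential C A I W P p q ev" and I: "injective_object C I"
  shows "injective_object C W"
proof -
  have P: "is_product C W A P p q" and ev: "ev \<in> hom C P I"
    using ex unfolding is_exponential_def by auto
  have p: "p \<in> hom C P W" and q: "q \<in> hom C P A"
    using P unfolding is_product_def by auto
  have A: "A \<in> Ob C" and W: "W \<in> Ob C"
    using p q homD by blast+
  have "\<exists>v \<in> hom C Y W. v \<cdot> m = u"
    if m: "m \<in> hom C X Y" and u: "u \<in> hom C X W" and mon: "monic C m" for X Y m u
  proof -
    obtain Q r s where Q: "is_product C X A Q r s"
      using binary_product[OF homD(4)[OF m] A] by blast
    obtain Q' r' s' where Q': "is_product C Y A Q' r' s'"
      using binary_product[OF homD(5)[OF m] A] by blast
    have r: "r \<in> hom C Q X" and s: "s \<in> hom C Q A"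
      using Q unfolding is_product_def by auto
    have r': "r' \<in> hom C Q' Y" and s': "s' \<in> hom C Q' A"
      using Q' unfolding is_product_def by auto
    \<comment> \<open>Here \<open>h\<close> is u \<times> A, so \<open>ev \<cdot> h\<close> is the
      transpose of \<open>u\<close>; \<open>n\<close> below is m \<times> A.\<close>
    obtain h where h: "h \<in> hom C Q P" "p \<cdot> h = u \<cdot> r" "q \<cdot> h = s"
      using product_pairing[OF P Comp_hom[OF r u] s] by blast
    obtain n where n: "n \<in> hom C Q Q'" "r' \<cdot> n = m \<cdot> r" "s' \<cdot> n = s"
      using product_pairing[OF Q' Comp_hom[OF r m] s] by blast
    have nmon: "monic C n"
    proof (rule monicI[OF n(1)])
      fix Z a b assume a: "a \<in> hom C Z Q" and b: "b \<in> hom C Z Q" and eq: "n \<cdot> a = n \<cdot> b"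
      have "m \<cdot> (r \<cdot> a) = m \<cdot> (r \<cdot> b)"
        using eq Comp_assoc[OF a r m] Comp_assoc[OF b r m] n(2)
          Comp_assoc[OF a n(1) r'] Comp_assoc[OF b n(1) r'] by simp
      then have "r \<cdot> a = r \<cdot> b"
        using monicD[OF mon m Comp_hom[OF a r] Comp_hom[OF b r]] by simp
      moreover have "s \<cdot> a = s \<cdot> b"
        using eq n(3) Comp_assoc[OF a n(1) s'] Comp_assoc[OF b n(1) s'] by simp
      ultimately show "a = b"
        using product_ext[OF Q a b] by simp
    qed
    have f: "ev \<cdot> h \<in> hom C Q I"
      using Comp_hom h ev by blast
    obtain f' where f': "f' \<in> hom C Q' I" "f' \<cdot> n = ev \<cdot> h"
      using injective_extend[OF I nmon n(1) f] by blast
    have "\<exists>!g. g \<in> hom C Y W \<and>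
        (\<exists>h \<in> hom C Q' P. p \<cdot> h = g \<cdot> r' \<and> q \<cdot> h = s' \<and> ev \<cdot> h = f')"
      using ex Q' f'(1) unfolding is_exponential_def by blast
    then obtain v h' where v: "v \<in> hom C Y W"
      and h': "h' \<in> hom C Q' P" "p \<cdot> h' = v \<cdot> r'" "q \<cdot> h' = s'" "ev \<cdot> h' = f'"
      by blast
    \<comment> \<open>Both \<open>u\<close> (via \<open>h\<close>) and \<open>v \<cdot> m\<close>
      (via \<open>h' \<cdot> n\<close>) have transpose \<open>ev \<cdot> h\<close>.\<close>
    have "\<exists>!g. g \<in> hom C X W \<and>
        (\<exists>k \<in> hom C Q P. p \<cdot> k = g \<cdot> r \<and> q \<cdot> k = s \<and> ev \<cdot> k = ev \<cdot> h)"
      using ex Q f unfolding is_exponential_def by blast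
    moreover have "p \<cdot> (h' \<cdot> n) = (v \<cdot> m) \<cdot> r" "q \<cdot> (h' \<cdot> n) = s" "ev \<cdot> (h' \<cdot> n) = ev \<cdot> h"
      using Comp_assoc[OF n(1) h'(1) p] Comp_assoc[OF n(1) h'(1) q] Comp_assoc[OF n(1) h'(1) ev]
        Comp_assoc[OF n(1) r' v] Comp_assoc[OF r m v] h' n f' by simp_all
    ultimately have "v \<cdot> m = u"
      using Comp_hom[OF n(1) h'(1)] Comp_hom[OF m v] u h by blast
    then show ?thesis
      using v by blast
  qed
  then show ?thesis
    using W unfolding injective_object_def by blast
qed

text \<open>The arrow \<sigma> sends a to {a}: it is the transpose of the characteristic arrow
  \<chi> of the diagonal \<open>d\<close>. If {f} = {g}, then \<chi>(g, f) = \<chi>(f, f) is true,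
  so (g, f) lies on the diagonal.\<close>

lemma singleton_monic:
  assumes cl: "is_subobject_classifier C T \<Omega> tr" and ex: "is_exponential C A \<Omega> W P p q ev"
  obtains \<sigma> where "\<sigma> \<in> hom C A W" "monic C \<sigma>"
proof -
  have P: "is_product C W A P p q" and ev: "ev \<in> hom C P \<Omega>"
    using ex unfolding is_exponential_def by auto
  have tr: "tr \<in> hom C T \<Omega>"
    using cl unfolding is_subobject_classifier_def by auto
  have p: "p \<in> hom C P W" and q: "q \<in> hom C P A"
    using P unfolding is_product_def by auto
  have A: "A \<in> Ob C" and AI: "Ident C A \<in> hom C A A"
    using q homD Ident_hom by blast+
  obtain Q r s where Q: "is_product C A A Q r s"
    using binary_product[OF A A] by blast
  have r: "r \<in> hom C Q A" and s: "s \<in> hom C Q A"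
    using Q unfolding is_product_def by auto
  obtain d where d: "d \<in> hom C A Q" "r \<cdot> d = Ident C A" "s \<cdot> d = Ident C A"
    using product_pairing[OF Q AI AI] by blast
  have "monic C d"
    using monic_of_monic_Comp[OF _ d(1) r] d(2) monic_Ident[OF A] by simp
  then obtain \<chi> t where chi: "\<chi> \<in> hom C Q \<Omega>" and t: "t \<in> hom C A T"
    and pb: "is_pullback C \<chi> tr d t"
    using cl d(1) unfolding is_subobject_classifier_def by blast
  have "\<exists>!g. g \<in> hom C A W \<and> (\<exists>h \<in> hom C Q P. p \<cdot> h = g \<cdot> r \<and> q \<cdot> h = s \<and> ev \<cdot> h = \<chi>)"
    using ex Q chi unfolding is_exponential_def by blast
  then obtain \<sigma> h where \<sigma>: "\<sigma> \<in> hom C A W"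
    and h: "h \<in> hom C Q P" "p \<cdot> h = \<sigma> \<cdot> r" "q \<cdot> h = s" "ev \<cdot> h = \<chi>"
    by blast
  have "monic C \<sigma>"
  proof (rule monicI[OF \<sigma>])
    fix X f g assume f: "f \<in> hom C X A" and g: "g \<in> hom C X A" and eq: "\<sigma> \<cdot> f = \<sigma> \<cdot> g"
    have df: "d \<cdot> f \<in> hom C X Q"
      using Comp_hom f d by blast
    have rsdf: "r \<cdot> (d \<cdot> f) = f" "s \<cdot> (d \<cdot> f) = f"
      using Comp_assoc[OF f d(1) r] Comp_assoc[OF f d(1) s] d Ident_Comp[OF f] by simp_all
    \<comment> \<open>\<open>y\<close> is the pair (g, f), to be compared with
      \<open>d \<cdot> f\<close>, the pair (f, f). Since \<open>h\<close> is \<sigma> \<times> A, it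
      identifies the two.\<close>
    obtain y where y: "y \<in> hom C X Q" "r \<cdot> y = g" "s \<cdot> y = f"
      using product_pairing[OF Q g f] by blast
    have "p \<cdot> (h \<cdot> (d \<cdot> f)) = p \<cdot> (h \<cdot> y)"
      using Comp_assoc[OF df h(1) p] Comp_assoc[OF y(1) h(1) p] Comp_assoc[OF df r \<sigma>]
        Comp_assoc[OF y(1) r \<sigma>] h(2) rsdf y eq by simp
    moreover have "q \<cdot> (h \<cdot> (d \<cdot> f)) = q \<cdot> (h \<cdot> y)"
      using Comp_assoc[OF df h(1) q] Comp_assoc[OF y(1) h(1) q] h(3) rsdf y by simp
    ultimately have "h \<cdot> (d \<cdot> f) = h \<cdot> y"
      using product_ext[OF P] Comp_hom df y h by blast
    then have "\<chi> \<cdot> y = \<chi> \<cdot> (d \<cdot> f)"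
      using Comp_assoc[OF df h(1) ev] Comp_assoc[OF y(1) h(1) ev] h(4) by simp
    also have "\<dots> = tr \<cdot> (t \<cdot> f)"
      using Comp_assoc[OF f d(1) chi] Comp_assoc[OF f t tr] pb by (simp add: is_pullback_def)
    finally obtain w where w: "w \<in> hom C X A" "d \<cdot> w = y"
      using pb homD[OF chi] homD[OF tr] homD[OF d(1)] y(1) Comp_hom[OF f t]
      unfolding is_pullback_def by metis
    have "g = w" "f = w"
      using y w Comp_assoc[OF w(1) d(1) r] Comp_assoc[OF w(1) d(1) s] d Ident_Comp[OF w(1)]
      by simp_all
    then show "f = g"
      by simp
  qed
  then show thesis
    using that \<sigma> by blast
qed

lemma enough_injectives:
  assumes "A \<in> Ob C"
  obtains e I where "e \<in> hom C A I" "monic C e" "injective_object C I"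
proof -
  obtain T \<Omega> tr where cl: "is_subobject_classifier C T \<Omega> tr"
    using subobject_classifier by blast
  have \<Omega>: "injective_object C \<Omega>"
    using classifier_injective[OF cl] .
  then obtain W P p q ev where ex: "is_exponential C A \<Omega> W P p q ev"
    using exponentials assms unfolding has_exponentials_def injective_object_def by blast
  then show thesis
    using singleton_monic[OF cl ex] exponential_injective[OF ex \<Omega>] that by blast
qed

end

section \<open>Existence of injective hulls\<close>

context locally_finite_topos
begin

lemma essential_injective_exists:
  assumes A: "A \<in> Ob C"
  shows "\<exists>e E. essential_extension C A e E \<and> injective_object C E"
proof -
  define emb where "emb E e \<longleftrightarrow> e \<in> hom C A E \<and> monic C e \<and> injective_object C E" for E e
  obtain I i where "emb I i"
    using enough_injectives[OF A] unfolding emb_def by blast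
  \<comment> \<open>Minimality is exploited through \<open>card_seteq\<close> below, which needs the
    finiteness of \<open>hom C E E\<close>.\<close>
  then have "\<exists>E. (\<exists>e. emb E e) \<and>
      (\<forall>E'. (\<exists>e'. emb E' e') \<longrightarrow> card (hom C E E) \<le> card (hom C E' E'))"
    using ex_has_least_nat[of "\<lambda>E. \<exists>e. emb E e" I "\<lambda>E. card (hom C E E)"] by blast
  then obtain E e where "emb E e"
    and least: "\<And>E' e'. emb E' e' \<Longrightarrow> card (hom C E E) \<le> card (hom C E' E')"
    by blast
  then have e: "e \<in> hom C A E" "monic C e" and E: "injective_object C E"
    unfolding emb_def by auto
  have EO: "E \<in> Ob C" and EI: "Ident C E \<in> hom C E E"
    using e homD Ident_hom by blast+
  have idem: "t = Ident C E" if t: "t \<in> hom C E E" "t \<cdot> t = t" "t \<cdot> e = e" for t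
  proof -
    obtain Y s r where s: "s \<in> hom C Y E" and r: "r \<in> hom C E Y"
      and rs: "r \<cdot> s = Ident C Y" and sr: "s \<cdot> r = t"
      using idempotent_splits[OF t(1,2)] by blast
    have re: "r \<cdot> e \<in> hom C A Y"
      using Comp_hom e r by blast
    have "s \<cdot> (r \<cdot> e) = e"
      using Comp_assoc[OF e(1) r s] sr t by simp
    then have "monic C (r \<cdot> e)"
      using monic_of_monic_Comp[OF _ re s] e by simp
    then have le: "card (hom C E E) \<le> card (hom C Y Y)"
      using least re injective_retract[OF E s r rs] unfolding emb_def by blast
    \<comment> \<open>This embeds \<open>hom C Y Y\<close> into \<open>hom C E E\<close>, with
      inverse x \<mapsto> r x s on its image. By minimality it is onto, so the identity of
      \<open>E\<close> factors through \<open>s\<close>.\<close>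
    let ?\<phi> = "\<lambda>x. s \<cdot> (x \<cdot> r)"
    have retract: "(r \<cdot> (s \<cdot> (x \<cdot> r))) \<cdot> s = x" if x: "x \<in> hom C Y Y" for x
      using Comp_assoc[OF Comp_hom[OF r x] s r] rs Ident_Comp[OF Comp_hom[OF r x]]
        Comp_assoc[OF s r x] Comp_Ident[OF x] by simp
    have "inj_on ?\<phi> (hom C Y Y)"
      by (rule inj_onI) (metis retract)
    moreover have sub: "?\<phi> ` hom C Y Y \<subseteq> hom C E E"
      using Comp_hom r s by blast
    ultimately have "?\<phi> ` hom C Y Y = hom C E E"
      using card_seteq[OF locally_finite[OF EO EO] sub] le card_image by metis
    then have "Ident C E \<in> ?\<phi> ` hom C Y Y"
      using EI by simp
    then obtain x where x: "x \<in> hom C Y Y" "Ident C E = s \<cdot> (x \<cdot> r)"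
      by blast
    \<comment> \<open>Since t s = s, composing with \<open>t\<close> fixes every arrow of the form s
      z, and the identity is of this form.\<close>
    have "t = s \<cdot> (r \<cdot> (s \<cdot> (x \<cdot> r)))"
      using Comp_Ident[OF r] x(2) sr by simp
    also have "\<dots> = Ident C E"
      using Comp_assoc[OF Comp_hom[OF r x(1)] s r] rs Ident_Comp[OF Comp_hom[OF r x(1)]] x(2) by simp
    finally show ?thesis .
  qed
  have split: "\<exists>y \<in> hom C E E. y \<cdot> u = Ident C E" if u: "u \<in> hom C E E" "u \<cdot> e = e" for u
  proof -
    \<comment> \<open>The members of the left ideal generated by \<open>u\<close> that fix
      \<open>e\<close>; \<open>u\<close> is one of them. An idempotent in this set is the identity
      by \<open>idem\<close>, and the witness \<open>y\<close> of its membership is then a left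
      inverse of \<open>u\<close>.\<close>
    let ?S = "{x \<in> hom C E E. x \<cdot> e = e \<and> (\<exists>y \<in> hom C E E. x = y \<cdot> u)}"
    have "\<exists>x \<in> ?S. x \<cdot> x = x"
    proof (rule finite_semigroup_idempotent[where mult = "\<lambda>x y. x \<cdot> y"])
      show "finite ?S"
        using locally_finite[OF EO EO] by simp
      show "?S \<noteq> {}"
        using u EI Ident_Comp[OF u(1)] by fastforce
      fix a b assume a: "a \<in> ?S" and b: "b \<in> ?S"
      then obtain y where aE: "a \<in> hom C E E" "a \<cdot> e = e" and bE: "b \<in> hom C E E" "b \<cdot> e = e"
        and y: "y \<in> hom C E E" "b = y \<cdot> u"
        by blast
      have "(a \<cdot> b) \<cdot> e = e"
        using Comp_assoc[OF e(1) bE(1) aE(1)] aE(2) bE(2) by simp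
      moreover have "a \<cdot> b = (a \<cdot> y) \<cdot> u"
        using Comp_assoc[OF u(1) y(1) aE(1)] y(2) by simp
      ultimately show "a \<cdot> b \<in> ?S"
        using Comp_hom[OF bE(1) aE(1)] Comp_hom[OF y(1) aE(1)] by blast
    next
      fix a b c assume "a \<in> ?S" "b \<in> ?S" "c \<in> ?S"
      then show "(a \<cdot> b) \<cdot> c = a \<cdot> (b \<cdot> c)"
        using Comp_assoc by blast
    qed
    then show ?thesis
      using idem by blast
  qed
  \<comment> \<open>Extending \<open>e\<close> along \<open>g \<cdot> e\<close> yields
    \<open>v\<close> such that \<open>v \<cdot> g\<close> fixes \<open>e\<close>. Hence
    \<open>v \<cdot> g\<close> has a left inverse, and \<open>g\<close> is split monic.\<close>
  have "monic C g" if g: "g \<in> hom C E Z" and ge: "monic C (g \<cdot> e)" for Z g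
  proof -
    obtain v where v: "v \<in> hom C Z E" "v \<cdot> (g \<cdot> e) = e"
      using injective_extend[OF E ge Comp_hom[OF e(1) g] e(1)] by blast
    obtain y where y: "y \<in> hom C E E" "y \<cdot> (v \<cdot> g) = Ident C E"
      using split[OF Comp_hom[OF g v(1)]] Comp_assoc[OF e(1) g v(1)] v(2) by auto
    then have "monic C ((y \<cdot> v) \<cdot> g)"
      using Comp_assoc[OF g v(1) y(1)] monic_Ident[OF EO] by simp
    then show ?thesis
      using monic_of_monic_Comp g Comp_hom[OF v(1) y(1)] by blast
  qed
  then show ?thesis
    using e E unfolding essential_extension_def by blast
qed

end

theorem theorem5:
  fixes \<E> :: "('o, 'a, 'm) cat_scheme" and A :: 'o
  assumes "locally_finite_topos \<E>" and "A \<in> Ob \<E>"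
  shows "(\<exists>e E. essential_extension \<E> A e E \<and> injective_object \<E> E) \<and>
    (\<forall>e E f F.
      essential_extension \<E> A e E \<and> injective_object \<E> E \<and>
      essential_extension \<E> A f F \<and> injective_object \<E> F \<longrightarrow>
      (\<exists>h. iso_between \<E> h E F \<and> f = h \<cdot>\<^bsub>\<E>\<^esub> e))"
proof -
  interpret locally_finite_topos \<E>
    by (rule assms(1))
  have fin: "finite (hom \<E> E E)" if "injective_object \<E> E" for E
    using that locally_finite unfolding injective_object_def by blast
  show ?thesis
    using essential_injective_exists[OF assms(2)] essential_injective_unique[OF fin fin] by blast
qed

end
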